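(* Let $X\subset\mathbb{R}^d$ be a set of $n$ points, let $1\le k\le n$ be an integer and let $\epsilon\in(0,1/2]$. Then there exist a dimension $d'=O\!\left(\log\frac{n}{k}\,/\,\epsilon^2\right)$ and a randomized mapping (a distribution over mappings) $f:\mathbb{R}^d\to\mathbb{R}^{d'}$ that is a locality preserving embedding for $X$ (with $Y=\mathbb{R}^d$, $Z=\mathbb{R}^{d'}$, both with the Euclidean metric) with distortion $D=(1+\epsilon)^2$, probability of correctness $P=2/3$ and locality parameter $k$.
   Context: For $c\ge 1$, a point $x\in X$ is a $c$-approximate nearest neighbor of $q$ in $X$ if $d(q,x)\le c\cdot d(q,p')$ for all $p'\in X$. $\eta$-$k$ANNs problem: given a finite point set $W$, a query $w$, $\eta\ge 0$ and $1\le k\le |W|$, report a sequence $S=\{p_1,\dots,p_k\}$ of $k$ distinct points of $W$ such that the $i$-th point $p_i$ is a $(1+\eta)$-approximation to the $i$-th nearest neighbor of $w$ in $W$ (for each $i$). Locality preserving embedding: let $(Y,d_Y)$, $(Z,d_Z)$ be metric spaces and $X\subseteq Y$. A distribution over mappings $f:Y\to Z$ is a locality preserving embedding with distortion $D\ge1$, probability of correctness $P\in[0,1]$ and locality parameter $k$ if for all $\eta\ge 0$ and all $q\in Y$, with probability at least $P$ the following holds: whenever $S=\{f(p_1),\dots,f(p_k)\}$ (with $p_i\in X$) is a solution to $\eta$-$k$ANNs for the query $f(q)$ in $f(X)$ for which there is a set $S'\subseteq f(X)$ (the points visited by the search) with $S\subseteq S'$ such that $S$ consists of the $k$ points of $S'$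 nearest to $f(q)$, $S$ is ordered by distance from $f(q)$ (so $f(p_k)$ is farthest), and every $z\in f(X)\setminus S'$ satisfies $d_Z(z,f(q))>d_Z(f(p_k),f(q))/(1+\eta)$, there exists $f(x)\in S$ such that $x$ is a $(D(1+\eta))$-approximate nearest neighbor of $q$ in $X$. The $O(\cdot)$ hides an absolute constant and is understood asymptotically as $n/k$ grows. *)

theory Defs
  imports "HOL-Probability.Probability" "HOL-Library.Landau_Symbols"
begin

text \<open>
  The Euclidean space of dimension \<open>n\<close>, carried by \<open>topspace (Euclidean_space n)\<close>: the functions
  \<open>nat \<Rightarrow> real\<close> that vanish from index \<open>n\<close> on.
\<close>

definition Rn_metric :: "nat \<Rightarrow> (nat \<Rightarrow> real) metric" where
  "Rn_metric n = metric (topspace (Euclidean_space n), \<lambda>x y. L2_set (\<lambda>i. x i - y i) {..<n})"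

lemma Metric_space_Rn:
  "Metric_space (topspace (Euclidean_space n)) (\<lambda>x y. L2_set (\<lambda>i. x i - y i) {..<n})"
proof
  show "L2_set (\<lambda>i. x i - y i) {..<n} = L2_set (\<lambda>i. y i - x i) {..<n}" for x y :: "nat \<Rightarrow> real"
    by (simp add: L2_set_def power2_commute)
  show "L2_set (\<lambda>i. x i - y i) {..<n} = 0 \<longleftrightarrow> x = y"
    if "x \<in> topspace (Euclidean_space n)" "y \<in> topspace (Euclidean_space n)" for x y
  proof -
    have "L2_set (\<lambda>i. x i - y i) {..<n} = 0 \<longleftrightarrow> (\<forall>i<n. x i = y i)"
      by (auto simp: L2_set_eq_0_iff)
    also have "\<dots> \<longleftrightarrow> x = y"
      using that unfolding topspace_Euclidean_space fun_eq_iff mem_Collect_eq by (metis not_le)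
    finally show ?thesis .
  qed
  show "L2_set (\<lambda>i. x i - z i) {..<n}
      \<le> L2_set (\<lambda>i. x i - y i) {..<n} + L2_set (\<lambda>i. y i - z i) {..<n}" for x y z :: "nat \<Rightarrow> real"
    using L2_set_triangle_ineq[of "\<lambda>i. x i - y i" "\<lambda>i. y i - z i" "{..<n}"] by simp
qed (simp add: L2_set_nonneg)

lemma mspace_Rn_metric [simp]: "mspace (Rn_metric n) = topspace (Euclidean_space n)"
  by (simp only: Rn_metric_def Metric_space.mspace_metric[OF Metric_space_Rn])

lemma mdist_Rn_metric: "mdist (Rn_metric n) x y = L2_set (\<lambda>i. x i - y i) {..<n}"
  by (simp only: Rn_metric_def Metric_space.mdist_metric[OF Metric_space_Rn])

definition approx_nn :: "'a metric \<Rightarrow> 'a set \<Rightarrow> real \<Rightarrow> 'a \<Rightarrow> 'a \<Rightarrow> bool" where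
  "approx_nn m X c q x \<longleftrightarrow> x \<in> X \<and> (\<forall>p\<in>X. mdist m q x \<le> c * mdist m q p)"

text \<open>
  The point set of a nearest neighbor problem is an indexed family \<open>g p\<close>, \<open>p \<in> I\<close>; a plain point set
  \<open>W\<close> is the family \<open>\<lambda>x. x\<close> over \<open>W\<close>. For a mapping \<open>f\<close> the point set \<open>f(X)\<close> is the family \<open>f p\<close>,
  \<open>p \<in> X\<close>: the images of distinct points of \<open>X\<close> count as distinct points even if they coincide, and
  a reported image determines the point of \<open>X\<close> it belongs to. (If instead coinciding images were
  identified, and any preimage of a reported image accepted, then a constant mapping would be
  locality preserving for trivial reasons.)

  \<open>nn_order m g I w ns\<close>: the list \<open>ns\<close> enumerates the family by distance from \<open>w\<close>, so that \<open>ns ! i\<close>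
  is the nearest neighbor number \<open>i + 1\<close>; its distance from \<open>w\<close> does not depend on how ties are
  broken.
\<close>

definition nn_order :: "'b metric \<Rightarrow> ('a \<Rightarrow> 'b) \<Rightarrow> 'a set \<Rightarrow> 'b \<Rightarrow> 'a list \<Rightarrow> bool" where
  "nn_order m g I w ns \<longleftrightarrow>
     distinct ns \<and> set ns = I \<and> sorted (map (\<lambda>p. mdist m w (g p)) ns)"

definition kann_solution ::
    "'b metric \<Rightarrow> ('a \<Rightarrow> 'b) \<Rightarrow> 'a set \<Rightarrow> 'b \<Rightarrow> real \<Rightarrow> nat \<Rightarrow> 'a list \<Rightarrow> bool" where
  "kann_solution m g I w \<eta> k ps \<longleftrightarrow>
     length ps = k \<and> distinct ps \<and> set ps \<subseteq> I \<and>
     (\<exists>ns. nn_order m g I w ns \<and>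
           (\<forall>i<k. mdist m w (g (ps ! i)) \<le> (1 + \<eta>) * mdist m w (g (ns ! i))))"

text \<open>\<open>V\<close> is the set of points visited by the search that reports \<open>ps\<close>.\<close>

definition search_result ::
    "'b metric \<Rightarrow> ('a \<Rightarrow> 'b) \<Rightarrow> 'a set \<Rightarrow> 'b \<Rightarrow> real \<Rightarrow> 'a list \<Rightarrow> 'a set \<Rightarrow> bool" where
  "search_result m g I w \<eta> ps V \<longleftrightarrow>
     set ps \<subseteq> V \<and> V \<subseteq> I \<and>
     (\<forall>p\<in>set ps. \<forall>v\<in>V - set ps. mdist m w (g p) \<le> mdist m w (g v)) \<and>
     sorted (map (\<lambda>p. mdist m w (g p)) ps) \<and>
     (\<forall>z\<in>I - V. mdist m (g z) w > mdist m (g (last ps)) w / (1 + \<eta>))"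

definition preserves_locality ::
    "'a metric \<Rightarrow> 'b metric \<Rightarrow> 'a set \<Rightarrow> real \<Rightarrow> nat \<Rightarrow> real \<Rightarrow> 'a \<Rightarrow> ('a \<Rightarrow> 'b) \<Rightarrow> bool" where
  "preserves_locality mY mZ X D k \<eta> q f \<longleftrightarrow>
     (\<forall>ps. kann_solution mZ f X (f q) \<eta> k ps \<and> (\<exists>V. search_result mZ f X (f q) \<eta> ps V) \<longrightarrow>
           (\<exists>x\<in>set ps. approx_nn mY X (D * (1 + \<eta>)) q x))"

definition metric_borel :: "'a metric \<Rightarrow> 'a measure" where
  "metric_borel m = sigma (mspace m) {U. openin (mtopology_of m) U}"

text \<open>
  A distribution over mappings is the law of a stochastic process: a probability measure on the
  product \<open>\<sigma>\<close>-algebra, for which every evaluation \<open>f \<mapsto> f y\<close> is a random variable.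
\<close>

definition mapping_distribution :: "'a metric \<Rightarrow> 'b metric \<Rightarrow> ('a \<Rightarrow> 'b) measure \<Rightarrow> bool" where
  "mapping_distribution mY mZ F \<longleftrightarrow>
     prob_space F \<and> sets F = sets (Pi\<^sub>M (mspace mY) (\<lambda>_. metric_borel mZ))"

text \<open>
  Non-measurable sets have \<open>measure\<close> zero, so for positive \<open>P\<close> the bound below includes the
  measurability of the event.
\<close>

definition locality_preserving_embedding ::
    "'a metric \<Rightarrow> 'b metric \<Rightarrow> 'a set \<Rightarrow> real \<Rightarrow> real \<Rightarrow> nat \<Rightarrow> ('a \<Rightarrow> 'b) measure \<Rightarrow> bool" where
  "locality_preserving_embedding mY mZ X D P k F \<longleftrightarrow>
     finite X \<and> X \<subseteq> mspace mY \<and> 1 \<le> D \<and> 0 \<le> P \<and> P \<le> 1 \<and> 1 \<le> k \<and> k \<le> card X \<and>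
     mapping_distribution mY mZ F \<and>
     (\<forall>\<eta>\<ge>0. \<forall>q\<in>mspace mY. \<P>(f in F. preserves_locality mY mZ X D k \<eta> q f) \<ge> P)"

end

theory Submission
  imports Defs
begin

text \<open>
  The mapping is a scaled random sign matrix with \<open>d'\<close> rows. If no reported point is a good
  approximation, then either the image of the nearest neighbor of \<open>q\<close> has moved away from that of
  \<open>q\<close> by a factor larger than \<open>1 + \<epsilon>\<close>, or at least \<open>k\<close> of the \<open>n\<close> distances from \<open>q\<close> have
  been contracted by such a factor. The first event concerns one point only, so Chebyshev's
  inequality suffices. For the second, a single distance is contracted with probability at most
  \<open>exp (- d' \<epsilon>\<^sup>2 / 6) \<le> k / (6 n)\<close>, and Markov's inequality for the number of contracted distances
  replaces the union bound: this is why \<open>log (n / k)\<close> dimensions are enough instead of \<open>log n\<close>.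
\<close>

section \<open>Random sign matrices\<close>

text \<open>Entries are independent Rademacher signs rather than Gaussians: the support is then
  finite, the law is a \<open>pmf\<close>, and every real function on it is integrable.\<close>

definition sign_vector_pmf :: "nat set \<Rightarrow> (nat \<Rightarrow> real) pmf" where
  "sign_vector_pmf A = Pi_pmf A 0 (\<lambda>_. pmf_of_set {-1, 1})"

definition sign_matrix_pmf :: "nat \<Rightarrow> nat \<Rightarrow> (nat \<Rightarrow> nat \<Rightarrow> real) pmf" where
  "sign_matrix_pmf m d = Pi_pmf {..<m} (\<lambda>_. 0) (\<lambda>_. sign_vector_pmf {..<d})"

lemma finite_set_Pi_pmf:
  assumes "finite A" and "\<And>x. x \<in> A \<Longrightarrow> finite (set_pmf (p x))"
  shows "finite (set_pmf (Pi_pmf A dflt p))"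
  using assms by (simp add: set_Pi_pmf finite_PiE_dflt)

lemma finite_sign_vector_pmf: "finite A \<Longrightarrow> finite (set_pmf (sign_vector_pmf A))"
  unfolding sign_vector_pmf_def by (rule finite_set_Pi_pmf) auto

lemma finite_sign_matrix_pmf: "finite (set_pmf (sign_matrix_pmf m d))"
  unfolding sign_matrix_pmf_def by (rule finite_set_Pi_pmf) (auto intro: finite_sign_vector_pmf)

lemma integrable_sign_vector:
  "finite A \<Longrightarrow> integrable (sign_vector_pmf A) (g :: _ \<Rightarrow> real)"
  by (rule integrable_measure_pmf_finite[OF finite_sign_vector_pmf])

text \<open>Common form of the Markov, Chebyshev and Chernoff arguments below: each chooses a
  \<open>g\<close> that majorizes the indicator of the bad event.\<close>

lemma prob_le_expectation:
  fixes g :: "'a \<Rightarrow> real"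
  assumes "finite (set_pmf p)" and "\<And>x. x \<in> set_pmf p \<Longrightarrow> indicator E x \<le> g x"
  shows "measure_pmf.prob p E \<le> measure_pmf.expectation p g"
proof -
  have "measure_pmf.prob p E = measure_pmf.expectation p (indicator E)" by simp
  also have "\<dots> \<le> measure_pmf.expectation p g"
    by (rule integral_mono_AE)
       (use assms in \<open>auto intro: integrable_measure_pmf_finite simp: AE_measure_pmf_iff\<close>)
  finally show ?thesis .
qed

section \<open>Moments and Laplace transform of a signed sum\<close>

lemma expectation_sign_vector_insert:
  fixes h :: "(nat \<Rightarrow> real) \<Rightarrow> real"
  assumes "finite A" "x \<notin> A"
  shows "measure_pmf.expectation (sign_vector_pmf (insert x A)) h =
     (measure_pmf.expectation (sign_vector_pmf A) (\<lambda>s. h (s(x := 1))) +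
      measure_pmf.expectation (sign_vector_pmf A) (\<lambda>s. h (s(x := -1)))) / 2"
proof -
  \<comment> \<open>The new sign is drawn first and independently of the others; averaging over its
    two values is the induction step for both moments.\<close>
  have "sign_vector_pmf (insert x A) =
      pmf_of_set {-1, 1} \<bind> (\<lambda>y. map_pmf (\<lambda>s. s(x := y)) (sign_vector_pmf A))"
    using assms by (simp add: sign_vector_pmf_def Pi_pmf_insert' map_pmf_def)
  then have "measure_pmf.expectation (sign_vector_pmf (insert x A)) h =
      (\<Sum>y\<in>{-1, 1}. measure_pmf.expectation (map_pmf (\<lambda>s. s(x := y)) (sign_vector_pmf A)) h
        /\<^sub>R real (card {-1, 1 :: real}))"
    using assms by (simp only:, intro pmf_expectation_bind_pmf_of_set) (auto simp: finite_sign_vector_pmf)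
  then show ?thesis
    by (simp add: field_simps del: fun_upd_apply)
qed

lemma expectation_sign_vector_square:
  assumes "finite A"
  shows "measure_pmf.expectation (sign_vector_pmf A) (\<lambda>s. (\<Sum>j\<in>A. s j * v j)\<^sup>2) = (\<Sum>j\<in>A. (v j)\<^sup>2)"
  using assms
proof (induction A)
  case empty
  then show ?case by simp
next
  case (insert x A)
  let ?E = "measure_pmf.expectation (sign_vector_pmf A)"
  define Y where "Y = (\<lambda>s :: nat \<Rightarrow> real. \<Sum>j\<in>A. s j * v j)"
  have upd: "(\<Sum>j\<in>A. (s(x := y)) j * v j) = Y s" for s y
    using insert.hyps unfolding Y_def by (intro sum.cong) auto
  have "measure_pmf.expectation (sign_vector_pmf (insert x A)) (\<lambda>s. (\<Sum>j\<in>insert x A. s j * v j)\<^sup>2)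
     = (?E (\<lambda>s. (v x + Y s)\<^sup>2) + ?E (\<lambda>s. (- v x + Y s)\<^sup>2)) / 2"
    using insert.hyps by (simp add: expectation_sign_vector_insert upd del: fun_upd_apply) (simp add: upd)
  also have "\<dots> = ?E (\<lambda>s. ((v x + Y s)\<^sup>2 + (- v x + Y s)\<^sup>2) / 2)"
    using insert.hyps by (simp add: integrable_sign_vector)
  \<comment> \<open>Averaging over the sign of \<open>v x\<close> cancels the cross term.\<close>
  also have "(\<lambda>s. ((v x + Y s)\<^sup>2 + (- v x + Y s)\<^sup>2) / 2) = (\<lambda>s. (v x)\<^sup>2 + (Y s)\<^sup>2)"
    by (auto simp: power2_eq_square algebra_simps)
  also have "?E \<dots> = (v x)\<^sup>2 + ?E (\<lambda>s. (Y s)\<^sup>2)"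
    using insert.hyps by (simp add: integrable_sign_vector)
  finally show ?case
    using insert by (simp add: Y_def)
qed

text \<open>The constant 3 is the fourth moment of a standard Gaussian. Odd powers of
  \<open>v x\<close> cancel under the sign average, and the surviving mixed term
  \<open>6 * (v x)\<^sup>2 * (Y s)\<^sup>2\<close> has as expectation exactly the mixed term of the
  expanded right-hand side.\<close>

lemma expectation_sign_vector_power4:
  assumes "finite A"
  shows "measure_pmf.expectation (sign_vector_pmf A) (\<lambda>s. (\<Sum>j\<in>A. s j * v j) ^ 4)
    \<le> 3 * (\<Sum>j\<in>A. (v j)\<^sup>2)\<^sup>2"
  using assms
proof (induction A)
  case empty
  then show ?case by simp
next
  case (insert x A)
  let ?E = "measure_pmf.expectation (sign_vector_pmf A)"
  let ?S = "\<Sum>j\<in>A. (v j)\<^sup>2"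
  define Y where "Y = (\<lambda>s :: nat \<Rightarrow> real. \<Sum>j\<in>A. s j * v j)"
  have upd: "(\<Sum>j\<in>A. (s(x := y)) j * v j) = Y s" for s y
    using insert.hyps unfolding Y_def by (intro sum.cong) auto
  have "measure_pmf.expectation (sign_vector_pmf (insert x A)) (\<lambda>s. (\<Sum>j\<in>insert x A. s j * v j) ^ 4)
     = (?E (\<lambda>s. (v x + Y s) ^ 4) + ?E (\<lambda>s. (- v x + Y s) ^ 4)) / 2"
    using insert.hyps by (simp add: expectation_sign_vector_insert upd del: fun_upd_apply) (simp add: upd)
  also have "\<dots> = ?E (\<lambda>s. ((v x + Y s) ^ 4 + (- v x + Y s) ^ 4) / 2)"
    using insert.hyps by (simp add: integrable_sign_vector)
  also have "(\<lambda>s. ((v x + Y s) ^ 4 + (- v x + Y s) ^ 4) / 2)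
      = (\<lambda>s. (v x) ^ 4 + (6 * (v x)\<^sup>2 * (Y s)\<^sup>2 + (Y s) ^ 4))"
    by (auto simp: power4_eq_xxxx power2_eq_square algebra_simps)
  also have "?E \<dots> = (v x) ^ 4 + (6 * (v x)\<^sup>2 * ?E (\<lambda>s. (Y s)\<^sup>2) + ?E (\<lambda>s. (Y s) ^ 4))"
    using insert.hyps by (simp add: integrable_sign_vector)
  also have "\<dots> \<le> (v x) ^ 4 + (6 * (v x)\<^sup>2 * ?S + 3 * ?S\<^sup>2)"
    using insert by (simp add: Y_def expectation_sign_vector_square)
  also have "\<dots> \<le> 3 * ((v x)\<^sup>2 + ?S)\<^sup>2"
    using zero_le_even_power[of 4 "v x"] by (simp add: power2_eq_square power4_eq_xxxx algebra_simps)
  finally show ?case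
    using insert by simp
qed

text \<open>The product of \<open>1 - x + x\<^sup>2 / 2\<close> and
  \<open>1 + x + x\<^sup>2 / 2\<close> is \<open>1 + x ^ 4 / 4\<close>, hence at least 1, and the
  second factor is at most \<open>exp x\<close>.\<close>

lemma exp_minus_le_quadratic:
  fixes x :: real
  assumes "0 \<le> x"
  shows "exp (- x) \<le> 1 - x + x\<^sup>2 / 2"
proof -
  have "1 \<le> 1 + x ^ 4 / 4" by simp
  also have "\<dots> = (1 - x + x\<^sup>2 / 2) * (1 + x + x\<^sup>2 / 2)"
    by (simp add: power2_eq_square power4_eq_xxxx field_simps)
  also have "\<dots> \<le> (1 - x + x\<^sup>2 / 2) * exp x"
  proof (rule mult_left_mono)
    show "1 + x + x\<^sup>2 / 2 \<le> exp x" using exp_lower_Taylor_quadratic[OF assms] by simp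
    have "0 \<le> ((1 - x)\<^sup>2 + 1) / 2" by simp
    also have "\<dots> = 1 - x + x\<^sup>2 / 2" by (simp add: power2_eq_square field_simps)
    finally show "0 \<le> 1 - x + x\<^sup>2 / 2" .
  qed
  finally show ?thesis by (simp add: exp_minus field_simps)
qed

text \<open>The normalized square \<open>(Y s)\<^sup>2 / S\<close> has mean 1 and second moment at
  most 3. The quadratic bound on \<open>exp (- x)\<close> turns these two moments into a Laplace
  transform bound, which suffices for the lower tail.\<close>

lemma expectation_sign_vector_exp:
  fixes v :: "nat \<Rightarrow> real"
  assumes "finite A" and S: "(\<Sum>j\<in>A. (v j)\<^sup>2) = S" "S > 0" and "0 \<le> l"
  shows "measure_pmf.expectation (sign_vector_pmf A) (\<lambda>s. exp (- (l * (\<Sum>j\<in>A. s j * v j)\<^sup>2 / S)))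
    \<le> exp (- l + 3 / 2 * l\<^sup>2)"
proof -
  let ?E = "measure_pmf.expectation (sign_vector_pmf A)"
  define Y where "Y = (\<lambda>s :: nat \<Rightarrow> real. \<Sum>j\<in>A. s j * v j)"
  have "?E (\<lambda>s. exp (- (l * (Y s)\<^sup>2 / S))) \<le> ?E (\<lambda>s. 1 + (- (l / S) * (Y s)\<^sup>2 + l\<^sup>2 / (2 * S\<^sup>2) * (Y s) ^ 4))"
  proof (rule integral_mono)
    show "exp (- (l * (Y s)\<^sup>2 / S)) \<le> 1 + (- (l / S) * (Y s)\<^sup>2 + l\<^sup>2 / (2 * S\<^sup>2) * (Y s) ^ 4)" for s
      using exp_minus_le_quadratic[of "l * (Y s)\<^sup>2 / S"] assms
      by (simp add: power_mult_distrib power_divide field_simps)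
  qed (use assms in \<open>auto simp: integrable_sign_vector\<close>)
  also have "\<dots> = 1 + (- (l / S) * ?E (\<lambda>s. (Y s)\<^sup>2) + l\<^sup>2 / (2 * S\<^sup>2) * ?E (\<lambda>s. (Y s) ^ 4))"
    using assms by (simp add: integrable_sign_vector)
  also have "\<dots> \<le> 1 + (- (l / S) * S + l\<^sup>2 / (2 * S\<^sup>2) * (3 * S\<^sup>2))"
  proof -
    have "?E (\<lambda>s. (Y s)\<^sup>2) = S" "?E (\<lambda>s. (Y s) ^ 4) \<le> 3 * S\<^sup>2"
      using expectation_sign_vector_square[OF assms(1), of v]
        expectation_sign_vector_power4[OF assms(1), of v] S(1) by (auto simp: Y_def)
    then show ?thesis
      by (simp only:, intro add_left_mono mult_left_mono) auto
  qed
  also have "\<dots> = 1 + (- l + 3 / 2 * l\<^sup>2)"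
    using S by simp
  also have "\<dots> \<le> exp (- l + 3 / 2 * l\<^sup>2)"
    by (rule exp_ge_add_one_self)
  finally show ?thesis by (simp add: Y_def)
qed

section \<open>Variance of independent sums, and tail bounds for sign matrices\<close>

lemma expectation_Pi_pmf_sum_square:
  fixes h :: "'b \<Rightarrow> real"
  assumes "finite A" "finite (set_pmf p)" and 0: "measure_pmf.expectation p h = 0"
  shows "measure_pmf.expectation (Pi_pmf A dflt (\<lambda>_. p)) (\<lambda>w. (\<Sum>i\<in>A. h (w i))\<^sup>2)
    = real (card A) * measure_pmf.expectation p (\<lambda>y. (h y)\<^sup>2)"
  using assms(1)
proof (induction A)
  case empty
  then show ?case by simp
next
  case (insert x A)
  let ?P = "Pi_pmf A dflt (\<lambda>_. p)"
  define T where "T = (\<lambda>w. \<Sum>i\<in>A. h (w i))"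
  have fin: "finite (set_pmf ?P)"
    using insert.hyps assms by (intro finite_set_Pi_pmf) auto
  note int [simp] = integrable_measure_pmf_finite[OF fin] integrable_measure_pmf_finite[OF assms(2)]
  have upd: "(\<Sum>i\<in>insert x A. h ((w(x := y)) i)) = h y + T w" for w y
  proof -
    have "(\<Sum>i\<in>A. h ((w(x := y)) i)) = T w"
      using insert.hyps unfolding T_def by (intro sum.cong) auto
    then show ?thesis using insert.hyps by simp
  qed
  have "Pi_pmf (insert x A) dflt (\<lambda>_. p) = p \<bind> (\<lambda>y. map_pmf (\<lambda>w. w(x := y)) ?P)"
    using insert.hyps by (simp add: Pi_pmf_insert' map_pmf_def)
  then have "measure_pmf.expectation (Pi_pmf (insert x A) dflt (\<lambda>_. p)) (\<lambda>w. (\<Sum>i\<in>insert x A. h (w i))\<^sup>2)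
     = (\<Sum>y\<in>set_pmf p. pmf p y * measure_pmf.expectation ?P (\<lambda>w. (h y + T w)\<^sup>2))"
    using fin by (simp only:, subst pmf_expectation_bind[OF assms(2)]) (simp_all only: integral_map_pmf upd
        set_map_pmf finite_imageI real_scaleR_def order_refl)
  \<comment> \<open>The square is expanded so that the cross term carries the factor
    \<open>measure_pmf.expectation p h\<close>, which is 0.\<close>
  also have "\<dots> = (\<Sum>y\<in>set_pmf p. (h y)\<^sup>2 * pmf p y + 2 * measure_pmf.expectation ?P T * (h y * pmf p y)
      + measure_pmf.expectation ?P (\<lambda>w. (T w)\<^sup>2) * pmf p y)"
    by (intro sum.cong) (auto simp: power2_sum algebra_simps)
  also have "\<dots> = measure_pmf.expectation p (\<lambda>y. (h y)\<^sup>2)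
      + 2 * measure_pmf.expectation ?P T * measure_pmf.expectation p h
      + measure_pmf.expectation ?P (\<lambda>w. (T w)\<^sup>2)"
    using assms by (simp add: integral_measure_pmf_real[OF assms(2)] sum.distrib sum_pmf_eq_1
        flip: sum_distrib_left)
  finally show ?case
    using insert 0 by (simp add: T_def algebra_simps)
qed

text \<open>A Chernoff bound: the rows are independent, so the Laplace transform of the squared
  length factors into \<open>m\<close> copies of the bound for a single row.\<close>

lemma sign_matrix_contraction:
  fixes v :: "nat \<Rightarrow> real" and \<epsilon> :: real
  assumes S: "(\<Sum>j<d. (v j)\<^sup>2) = S" "S > 0" and e: "0 < \<epsilon>" "\<epsilon> \<le> 1 / 2"
  shows "measure_pmf.prob (sign_matrix_pmf m d)
      {w. (1 + \<epsilon>)\<^sup>2 * (\<Sum>i<m. (\<Sum>j<d. w i j * v j)\<^sup>2) \<le> real m * S} \<le> exp (- (real m * \<epsilon>\<^sup>2 / 6))"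
proof -
  define Y where "Y = (\<lambda>s :: nat \<Rightarrow> real. \<Sum>j<d. s j * v j)"
  \<comment> \<open>Minimizes \<open>- l * \<epsilon> + 3 / 2 * l\<^sup>2\<close>, the exponent per
    row once \<open>1 / (1 + \<epsilon>)\<^sup>2\<close> has been bounded by
    \<open>1 - \<epsilon>\<close>; the minimum is \<open>- (\<epsilon>\<^sup>2 / 6)\<close>.\<close>
  define l where "l = \<epsilon> / 3"
  let ?M = "sign_matrix_pmf m d"
  let ?B = "{w. (1 + \<epsilon>)\<^sup>2 * (\<Sum>i<m. (Y (w i))\<^sup>2) \<le> real m * S}"
  let ?c = "exp (l * real m / (1 + \<epsilon>)\<^sup>2)"
  have "measure_pmf.prob ?M ?B \<le> measure_pmf.expectation ?M (\<lambda>w. ?c * (\<Prod>i<m. exp (- (l * (Y (w i))\<^sup>2 / S))))"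
  proof (rule prob_le_expectation[OF finite_sign_matrix_pmf])
    fix w
    have "1 \<le> ?c * (\<Prod>i<m. exp (- (l * (Y (w i))\<^sup>2 / S)))" if "w \<in> ?B"
    proof -
      have "(\<Sum>i<m. (Y (w i))\<^sup>2) / S \<le> real m / (1 + \<epsilon>)\<^sup>2"
        using that S e by (simp add: field_simps)
      then have "l * ((\<Sum>i<m. (Y (w i))\<^sup>2) / S) \<le> l * (real m / (1 + \<epsilon>)\<^sup>2)"
        using e by (intro mult_left_mono) (auto simp: l_def)
      then have "0 \<le> l * real m / (1 + \<epsilon>)\<^sup>2 + (\<Sum>i<m. - (l * (Y (w i))\<^sup>2 / S))"
        by (simp add: sum_negf flip: sum_divide_distrib sum_distrib_left)
      also have "exp \<dots> = ?c * (\<Prod>i<m. exp (- (l * (Y (w i))\<^sup>2 / S)))"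
        by (simp only: exp_add exp_sum[OF finite_lessThan])
      finally show ?thesis by simp
    qed
    then show "indicator ?B w \<le> ?c * (\<Prod>i<m. exp (- (l * (Y (w i))\<^sup>2 / S)))"
      by (auto simp: indicator_def intro!: mult_nonneg_nonneg prod_nonneg)
  qed
  also have "\<dots> = ?c * (\<Prod>i<m. measure_pmf.expectation (sign_vector_pmf {..<d}) (\<lambda>s. exp (- (l * (Y s)\<^sup>2 / S))))"
    unfolding sign_matrix_pmf_def
    by (simp, subst expectation_prod_Pi_pmf) (auto simp: integrable_sign_vector)
  also have "\<dots> \<le> ?c * (\<Prod>i<m. exp (- l + 3 / 2 * l\<^sup>2))"
    using expectation_sign_vector_exp[of "{..<d}" v S l] S e
    by (intro mult_left_mono prod_mono) (auto simp: Y_def l_def)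
  also have "\<dots> = exp (real m * (l / (1 + \<epsilon>)\<^sup>2 - l + 3 / 2 * l\<^sup>2))"
    by (simp add: exp_of_nat_mult[symmetric] exp_add[symmetric] algebra_simps)
  also have "\<dots> \<le> exp (real m * (- (\<epsilon>\<^sup>2 / 6)))"
  proof -
    have "(1 + \<epsilon>)\<^sup>2 * (1 - \<epsilon>) = 1 + \<epsilon> * (1 - \<epsilon> - \<epsilon>\<^sup>2)"
      by (simp add: power2_eq_square algebra_simps)
    \<comment> \<open>Here \<open>\<epsilon> \<le> 1 / 2\<close> enters: it gives
      \<open>\<epsilon> + \<epsilon>\<^sup>2 \<le> 1\<close>.\<close>
    moreover have "\<epsilon> * \<epsilon> \<le> 1 / 2 * \<epsilon>"
      using e by (intro mult_right_mono) auto
    then have "0 \<le> 1 - \<epsilon> - \<epsilon>\<^sup>2"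
      using e unfolding power2_eq_square by linarith
    ultimately have "1 \<le> (1 + \<epsilon>)\<^sup>2 * (1 - \<epsilon>)"
      using e by simp
    then have "1 / (1 + \<epsilon>)\<^sup>2 \<le> 1 - \<epsilon>"
      using e by (simp add: field_simps)
    then have "l * (1 / (1 + \<epsilon>)\<^sup>2) \<le> l * (1 - \<epsilon>)"
      using e by (intro mult_left_mono) (auto simp: l_def)
    moreover have "l * (1 - \<epsilon>) - l + 3 / 2 * l\<^sup>2 = - (\<epsilon>\<^sup>2 / 6)"
      by (simp add: l_def power2_eq_square field_simps)
    ultimately have "l / (1 + \<epsilon>)\<^sup>2 - l + 3 / 2 * l\<^sup>2 \<le> - (\<epsilon>\<^sup>2 / 6)"
      by simp
    then have "real m * (l / (1 + \<epsilon>)\<^sup>2 - l + 3 / 2 * l\<^sup>2) \<le> real m * (- (\<epsilon>\<^sup>2 / 6))"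
      by (intro mult_left_mono) auto
    then show ?thesis by simp
  qed
  finally show ?thesis by (simp add: Y_def)
qed

text \<open>Chebyshev's inequality: the square of one row's signed sum has mean \<open>S\<close> and
  variance at most \<open>2 * S\<^sup>2\<close>, and variances add over the rows. A constant failure
  probability is enough, since this is applied to the nearest neighbor only.\<close>

lemma sign_matrix_expansion:
  fixes v :: "nat \<Rightarrow> real" and \<epsilon> :: real
  assumes S: "(\<Sum>j<d. (v j)\<^sup>2) = S" and e: "0 < \<epsilon>" and m: "3 \<le> real m * \<epsilon>\<^sup>2"
  shows "measure_pmf.prob (sign_matrix_pmf m d)
      {w. (\<Sum>i<m. (\<Sum>j<d. w i j * v j)\<^sup>2) > (1 + \<epsilon>)\<^sup>2 * (real m * S)} \<le> 1 / 6"
proof -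
  define Y where "Y = (\<lambda>s :: nat \<Rightarrow> real. \<Sum>j<d. s j * v j)"
  let ?M = "sign_matrix_pmf m d"
  let ?E = "measure_pmf.expectation (sign_vector_pmf {..<d})"
  let ?B = "{w. (\<Sum>i<m. (Y (w i))\<^sup>2) > (1 + \<epsilon>)\<^sup>2 * (real m * S)}"
  have mean: "?E (\<lambda>s. (Y s)\<^sup>2 - S) = 0"
    using expectation_sign_vector_square[of "{..<d}" v] S by (simp add: integrable_sign_vector Y_def)
  have "?E (\<lambda>s. ((Y s)\<^sup>2 - S)\<^sup>2) = ?E (\<lambda>s. (Y s) ^ 4 - 2 * S * (Y s)\<^sup>2 + S\<^sup>2)"
    by (intro Bochner_Integration.integral_cong) (auto simp: power2_eq_square power4_eq_xxxx algebra_simps)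
  also have "\<dots> = ?E (\<lambda>s. (Y s) ^ 4) - 2 * S * ?E (\<lambda>s. (Y s)\<^sup>2) + S\<^sup>2"
    by (simp add: integrable_sign_vector)
  also have "\<dots> \<le> 2 * S\<^sup>2"
    using expectation_sign_vector_square[of "{..<d}" v] expectation_sign_vector_power4[of "{..<d}" v] S
    by (simp add: Y_def power2_eq_square)
  finally have var: "?E (\<lambda>s. ((Y s)\<^sup>2 - S)\<^sup>2) \<le> 2 * S\<^sup>2" .
  have "S \<ge> 0" using S by (auto intro: sum_nonneg)
  have mpos: "real m > 0" using m by (cases "m = 0") auto
  show ?thesis
  proof (cases "S = 0")
    case True
    then have "v j = 0" if "j < d" for j
      using S that by (simp add: sum_nonneg_eq_0_iff)
    then show ?thesis using True by simp
  next
    case False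
    then have "S > 0" using \<open>S \<ge> 0\<close> by simp
    \<comment> \<open>The part linear in \<open>\<epsilon>\<close> of the deviation
      \<open>((1 + \<epsilon>)\<^sup>2 - 1) * (real m * S)\<close>; the quadratic part is
      nonnegative and is dropped.\<close>
    define t where "t = 2 * \<epsilon> * real m * S"
    have t: "t > 0" using \<open>S > 0\<close> e mpos by (simp add: t_def)
    have "measure_pmf.prob ?M ?B \<le> measure_pmf.expectation ?M (\<lambda>w. (\<Sum>i<m. (Y (w i))\<^sup>2 - S)\<^sup>2 / t\<^sup>2)"
    proof (rule prob_le_expectation[OF finite_sign_matrix_pmf])
      fix w
      have "1 \<le> (\<Sum>i<m. (Y (w i))\<^sup>2 - S)\<^sup>2 / t\<^sup>2" if "w \<in> ?B"
      proof -
        have "t + real m * S \<le> (1 + \<epsilon>)\<^sup>2 * (real m * S)"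
          using mult_nonneg_nonneg[of "\<epsilon>\<^sup>2" "real m * S"] \<open>S > 0\<close>
          by (simp add: t_def power2_eq_square algebra_simps)
        then have "t \<le> (\<Sum>i<m. (Y (w i))\<^sup>2 - S)"
          using that by (simp add: sum_subtractf)
        then have "t\<^sup>2 \<le> (\<Sum>i<m. (Y (w i))\<^sup>2 - S)\<^sup>2"
          using t by (intro power_mono) auto
        then show ?thesis using t by simp
      qed
      then show "indicator ?B w \<le> (\<Sum>i<m. (Y (w i))\<^sup>2 - S)\<^sup>2 / t\<^sup>2"
        by (auto simp: indicator_def)
    qed
    also have "\<dots> = real m * ?E (\<lambda>s. ((Y s)\<^sup>2 - S)\<^sup>2) / t\<^sup>2"
      unfolding sign_matrix_pmf_def
      using expectation_Pi_pmf_sum_square[of "{..<m}" "sign_vector_pmf {..<d}", OF _ _ mean]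
      by (simp add: finite_sign_vector_pmf)
    also have "\<dots> \<le> real m * (2 * S\<^sup>2) / t\<^sup>2"
      using var by (intro divide_right_mono mult_left_mono) auto
    also have "\<dots> = 1 / (2 * (real m * \<epsilon>\<^sup>2))"
      using \<open>S > 0\<close> e mpos by (simp add: t_def power2_eq_square field_simps)
    also have "\<dots> \<le> 1 / (2 * 3)"
      using m by (intro divide_left_mono) auto
    finally show ?thesis by (simp add: Y_def)
  qed
qed

section \<open>Locality\<close>

text \<open>If the image of the nearest neighbor has been visited, it is not reported, so it is at least as
  far away as the reported images; otherwise the stopping rule bounds these, up to the factor
  \<open>1 + \<eta>\<close>. In both cases \<open>k\<close> far points have been contracted.\<close>

lemma preserves_localityI:
  assumes "finite X" "p0 \<in> X" and c: "1 \<le> c" and \<eta>: "0 \<le> \<eta>"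
    and nearest: "\<And>p. p \<in> X \<Longrightarrow> mdist mY q p0 \<le> mdist mY q p"
    and expansion: "mdist mZ (h q) (h p0) \<le> c * mdist mY q p0"
    and contraction: "card {p \<in> X. c * mdist mZ (h q) (h p) < mdist mY q p} < k"
  shows "preserves_locality mY mZ X (c\<^sup>2) k \<eta> q h"
  unfolding preserves_locality_def
proof (intro allI impI, elim conjE exE, rule ccontr)
  fix ps V
  assume sol: "kann_solution mZ h X (h q) \<eta> k ps" and res: "search_result mZ h X (h q) \<eta> ps V"
    and neg: "\<not> (\<exists>x\<in>set ps. approx_nn mY X (c\<^sup>2 * (1 + \<eta>)) q x)"
  have ps: "length ps = k" "distinct ps" "set ps \<subseteq> X"
    using sol by (auto simp: kann_solution_def)
  have far: "c\<^sup>2 * (1 + \<eta>) * mdist mY q p0 < mdist mY q x" if "x \<in> set ps" for x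
  proof -
    have "\<not> approx_nn mY X (c\<^sup>2 * (1 + \<eta>)) q x" "x \<in> X" using neg that ps by blast+
    then obtain p where p: "p \<in> X" "\<not> mdist mY q x \<le> c\<^sup>2 * (1 + \<eta>) * mdist mY q p"
      unfolding approx_nn_def by blast
    \<comment> \<open>As \<open>p0\<close> is nearest, a point that fails against some
      \<open>p\<close> also fails against \<open>p0\<close>.\<close>
    have "c\<^sup>2 * (1 + \<eta>) * mdist mY q p0 \<le> c\<^sup>2 * (1 + \<eta>) * mdist mY q p"
      using nearest[OF p(1)] \<eta> by (intro mult_left_mono) auto
    with p(2) show ?thesis by linarith
  qed
  have near: "mdist mZ (h q) (h x) \<le> (1 + \<eta>) * mdist mZ (h q) (h p0)" if x: "x \<in> set ps" for x
  proof (cases "p0 \<in> V")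
    case True
    \<comment> \<open>The approximation factor is at least 1, so a reported \<open>p0\<close> would
      itself be a good approximation.\<close>
    have "p0 \<notin> set ps"
    proof
      assume "p0 \<in> set ps"
      moreover have "1 * 1 \<le> c\<^sup>2 * (1 + \<eta>)"
        using c \<eta> by (intro mult_mono) (auto simp: one_le_power)
      then have "1 * mdist mY q p0 \<le> c\<^sup>2 * (1 + \<eta>) * mdist mY q p0"
        by (intro mult_right_mono) auto
      ultimately show False using far[of p0] by simp
    qed
    then have "mdist mZ (h q) (h x) \<le> mdist mZ (h q) (h p0)"
      using res x True by (auto simp: search_result_def)
    also have "\<dots> \<le> (1 + \<eta>) * mdist mZ (h q) (h p0)"
      using mult_right_mono[of 1 "1 + \<eta>" "mdist mZ (h q) (h p0)"] \<eta> by simp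
    finally show ?thesis .
  next
    case False
    then have "mdist mZ (h p0) (h q) > mdist mZ (h (last ps)) (h q) / (1 + \<eta>)"
      using res \<open>p0 \<in> X\<close> by (auto simp: search_result_def)
    moreover have "mdist mZ (h q) (h x) \<le> mdist mZ (h q) (h (last ps))"
    proof -
      obtain i where i: "i < length ps" "x = ps ! i"
        using x by (auto simp: in_set_conv_nth)
      have "sorted (map (\<lambda>p. mdist mZ (h q) (h p)) ps)"
        using res by (simp add: search_result_def)
      then have "mdist mZ (h q) (h (ps ! i)) \<le> mdist mZ (h q) (h (ps ! (length ps - 1)))"
        using i sorted_nth_mono[of "map (\<lambda>p. mdist mZ (h q) (h p)) ps" i "length ps - 1"] by simp
      moreover have "ps \<noteq> []" using i by auto
      ultimately show ?thesis using i by (simp add: last_conv_nth)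
    qed
    moreover have "0 < 1 + \<eta>" using \<eta> by simp
    ultimately show ?thesis
      by (simp add: mdist_commute[of mZ _ "h q"] pos_divide_less_eq mult.commute)
  qed
  have "set ps \<subseteq> {p \<in> X. c * mdist mZ (h q) (h p) < mdist mY q p}"
  proof
    fix x assume x: "x \<in> set ps"
    \<comment> \<open>One factor \<open>c\<close> pays for the expansion of \<open>p0\<close>, the
      other for the contraction of \<open>x\<close>; this is why the distortion is
      \<open>c\<^sup>2\<close>.\<close>
    have "c * mdist mZ (h q) (h x) \<le> c * ((1 + \<eta>) * (c * mdist mY q p0))"
      using c \<eta> by (intro mult_left_mono order_trans[OF near[OF x]] expansion) auto
    also have "\<dots> = c\<^sup>2 * (1 + \<eta>) * mdist mY q p0"
      by (simp add: power2_eq_square)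
    also have "\<dots> < mdist mY q x" by (rule far[OF x])
    finally show "x \<in> {p \<in> X. c * mdist mZ (h q) (h p) < mdist mY q p}"
      using x ps by auto
  qed
  then have "card (set ps) \<le> card {p \<in> X. c * mdist mZ (h q) (h p) < mdist mY q p}"
    using \<open>finite X\<close> by (intro card_mono) auto
  then show False
    using contraction ps by (simp add: distinct_card)
qed

section \<open>Measurability\<close>

lemma openin_mtopology_of_subset: "{U. openin (mtopology_of m) U} \<subseteq> Pow (mspace m)"
  using openin_subset[of "mtopology_of m"] by auto

lemma space_metric_borel [simp]: "space (metric_borel m) = mspace m"
  by (simp add: metric_borel_def space_measure_of openin_mtopology_of_subset)

lemma openin_in_sets_metric_borel:
  assumes "openin (mtopology_of m) U"
  shows "U \<in> sets (metric_borel m)"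
  using assms by (simp add: metric_borel_def sets_measure_of openin_mtopology_of_subset sigma_sets.Basic)

text \<open>A coordinate changes by at most the distance, so it is continuous and preimages of open
  sets are open in the metric topology. Distances, being expressions in finitely many coordinates,
  then become measurable.\<close>

lemma measurable_Rn_coordinate:
  assumes "i < n"
  shows "(\<lambda>y. y i) \<in> borel_measurable (metric_borel (Rn_metric n))"
proof (rule borel_measurableI)
  fix S :: "real set" assume "open S"
  interpret Metric_space "topspace (Euclidean_space n)" "\<lambda>x y. L2_set (\<lambda>i. x i - y i) {..<n}"
    by (rule Metric_space_Rn)
  let ?U = "{y \<in> topspace (Euclidean_space n). y i \<in> S}"
  have "openin mtopology ?U"
    unfolding openin_mtopology
  proof (intro conjI allI impI)
    fix x assume x: "x \<in> ?U"
    then obtain e where e: "e > 0" "\<And>t. dist t (x i) < e \<Longrightarrow> t \<in> S"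
      using \<open>open S\<close> by (auto simp: open_dist)
    have "mball x e \<subseteq> ?U"
    proof
      fix y assume y: "y \<in> mball x e"
      have "\<bar>x i - y i\<bar> \<le> L2_set (\<lambda>i. \<bar>x i - y i\<bar>) {..<n}"
        using assms by (intro member_le_L2_set) auto
      also have "\<dots> = L2_set (\<lambda>i. x i - y i) {..<n}"
        by (simp add: L2_set_def)
      also have "\<dots> < e"
        using y by simp
      finally have "\<bar>x i - y i\<bar> < e" .
      then show "y \<in> ?U"
        using y e(2)[of "y i"] by (auto simp: dist_real_def abs_minus_commute)
    qed
    then show "\<exists>r>0. mball x r \<subseteq> ?U" using e by blast
  qed auto
  then have "?U \<in> sets (metric_borel (Rn_metric n))"
    by (intro openin_in_sets_metric_borel) (simp add: Rn_metric_def)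
  moreover have "(\<lambda>y. y i) -` S \<inter> space (metric_borel (Rn_metric n)) = ?U"
    by auto
  ultimately show "(\<lambda>y. y i) -` S \<inter> space (metric_borel (Rn_metric n)) \<in> sets (metric_borel (Rn_metric n))"
    by simp
qed

lemma measurable_Rn_mdist:
  assumes "f \<in> measurable M (metric_borel (Rn_metric n))" "g \<in> measurable M (metric_borel (Rn_metric n))"
  shows "(\<lambda>x. mdist (Rn_metric n) (f x) (g x)) \<in> borel_measurable M"
proof -
  have [measurable]: "(\<lambda>x. f x i) \<in> borel_measurable M" "(\<lambda>x. g x i) \<in> borel_measurable M" if "i < n" for i
    using measurable_compose[OF assms(1) measurable_Rn_coordinate[OF that]]
      measurable_compose[OF assms(2) measurable_Rn_coordinate[OF that]] by auto
  show ?thesis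
    unfolding mdist_Rn_metric L2_set_def by measurable
qed

section \<open>Measurability of the locality event\<close>

lemma pred_sorted_map:
  fixes g :: "'a \<Rightarrow> 'b \<Rightarrow> real"
  assumes "\<And>x. x \<in> set xs \<Longrightarrow> (\<lambda>w. g w x) \<in> borel_measurable M"
  shows "Measurable.pred M (\<lambda>w. sorted (map (g w) xs))"
  using assms
proof (induction xs)
  case (Cons a xs)
  have [measurable]: "(\<lambda>w. g w a) \<in> borel_measurable M" using Cons.prems by simp
  have "Measurable.pred M (\<lambda>w. \<forall>x\<in>set xs. g w a \<le> g w x)"
  proof (rule pred_intros_finite)
    fix x assume "x \<in> set xs"
    then have [measurable]: "(\<lambda>w. g w x) \<in> borel_measurable M" using Cons.prems by simp
    show "Measurable.pred M (\<lambda>w. g w a \<le> g w x)" by measurable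
  qed simp
  moreover have "Measurable.pred M (\<lambda>w. sorted (map (g w) xs))"
    using Cons by simp
  ultimately show ?case
    by simp
qed simp

text \<open>Reported lists, enumerations and visited sets all range over finite collections built
  from \<open>X\<close>, so the event is a finite Boolean combination of comparisons between
  measurable distances.\<close>

lemma pred_preserves_locality:
  fixes M :: "('a \<Rightarrow> 'b) measure"
  assumes X: "finite X" and k: "1 \<le> k" "k \<le> card X"
    and meas: "\<And>p. p \<in> X \<Longrightarrow> (\<lambda>f. mdist mZ (f q) (f p)) \<in> borel_measurable M"
  shows "Measurable.pred M (preserves_locality mY mZ X D k \<eta> q)"
proof -
  let ?g = "\<lambda>f p. mdist mZ (f q) (f p)"
  let ?L = "{xs. set xs \<subseteq> X \<and> distinct xs}"
  \<comment> \<open>Being an approximate nearest neighbor does not depend on \<open>f\<close>, so it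
    is moved into the index set: the event says that no list without a good point is ever
    reported.\<close>
  let ?P = "\<lambda>ps. length ps = k \<and> \<not> (\<exists>x\<in>set ps. approx_nn mY X (D * (1 + \<eta>)) q x)"
  have fin: "finite {xs \<in> ?L. Q xs}" for Q
    by (rule finite_subset[OF _ finite_subset_distinct[OF X]]) auto
  have less: "Measurable.pred M (\<lambda>f. ?g f p \<le> c * ?g f p')" "Measurable.pred M (\<lambda>f. ?g f p \<le> ?g f p')"
      "Measurable.pred M (\<lambda>f. ?g f p / c < ?g f p')"
    if "p \<in> X" "p' \<in> X" for p p' c
  proof -
    have "Measurable.pred M (\<lambda>f. u f \<le> c * v f) \<and> Measurable.pred M (\<lambda>f. u f \<le> v f) \<and>
        Measurable.pred M (\<lambda>f. u f / c < v f)"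
      if [measurable]: "u \<in> borel_measurable M" "v \<in> borel_measurable M" for u v :: "('a \<Rightarrow> 'b) \<Rightarrow> real"
      by (simp only: not_less[symmetric], intro conjI; measurable)
    from this[OF meas[OF that(1)] meas[OF that(2)]]
    show "Measurable.pred M (\<lambda>f. ?g f p \<le> c * ?g f p')" "Measurable.pred M (\<lambda>f. ?g f p \<le> ?g f p')"
      "Measurable.pred M (\<lambda>f. ?g f p / c < ?g f p')" by auto
  qed
  have kann: "Measurable.pred M (\<lambda>f. kann_solution mZ f X (f q) \<eta> k ps)"
    if ps: "ps \<in> {ps \<in> ?L. ?P ps}" for ps
  proof -
    have "Measurable.pred M (\<lambda>f. \<exists>ns\<in>{ns \<in> ?L. set ns = X}. sorted (map (?g f) ns) \<and>
        (\<forall>i\<in>{..<k}. ?g f (ps ! i) \<le> (1 + \<eta>) * ?g f (ns ! i)))"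
    proof (intro pred_intros_finite pred_intros_logic fin)
      fix ns assume ns: "ns \<in> {ns \<in> ?L. set ns = X}"
      then show "Measurable.pred M (\<lambda>f. sorted (map (?g f) ns))"
        by (intro pred_sorted_map meas) auto
      fix i assume "i \<in> {..<k}"
      \<comment> \<open>Both indices are in range: \<open>length ps = k\<close>, and
        \<open>length ns = card X\<close> is at least \<open>k\<close>.\<close>
      then have "ps ! i \<in> X" "ns ! i \<in> X"
        using ps ns k by (auto simp: subset_iff dest!: distinct_card)
      then show "Measurable.pred M (\<lambda>f. ?g f (ps ! i) \<le> (1 + \<eta>) * ?g f (ns ! i))"
        by (rule less)
    qed simp
    also have "(\<lambda>f. \<exists>ns\<in>{ns \<in> ?L. set ns = X}. sorted (map (?g f) ns) \<and>
        (\<forall>i\<in>{..<k}. ?g f (ps ! i) \<le> (1 + \<eta>) * ?g f (ns ! i)))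
      = (\<lambda>f. kann_solution mZ f X (f q) \<eta> k ps)"
      using ps by (auto simp: kann_solution_def nn_order_def fun_eq_iff)
    finally show ?thesis .
  qed
  have search: "Measurable.pred M (\<lambda>f. \<exists>V\<in>Pow X. search_result mZ f X (f q) \<eta> ps V)"
    if ps: "ps \<in> {ps \<in> ?L. ?P ps}" for ps
  proof (rule pred_intros_finite)
    fix V assume "V \<in> Pow X"
    have "ps \<noteq> []" using ps k by auto
    then have last: "last ps \<in> X" using ps by auto
    show "Measurable.pred M (\<lambda>f. search_result mZ f X (f q) \<eta> ps V)"
      unfolding search_result_def mdist_commute[of mZ _ "_ q"]
      using ps last \<open>V \<in> Pow X\<close> X
      by (intro pred_intros_finite pred_intros_logic pred_sorted_map less meas)
         (auto intro: finite_subset)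
  qed (use X in simp)
  have "Measurable.pred M (\<lambda>f. \<forall>ps\<in>{ps \<in> ?L. ?P ps}.
      \<not> (kann_solution mZ f X (f q) \<eta> k ps \<and> (\<exists>V\<in>Pow X. search_result mZ f X (f q) \<eta> ps V)))"
    by (intro pred_intros_finite pred_intros_logic fin kann search)
  also have "(\<lambda>f. \<forall>ps\<in>{ps \<in> ?L. ?P ps}.
      \<not> (kann_solution mZ f X (f q) \<eta> k ps \<and> (\<exists>V\<in>Pow X. search_result mZ f X (f q) \<eta> ps V)))
    = preserves_locality mY mZ X D k \<eta> q"
    unfolding preserves_locality_def fun_eq_iff kann_solution_def search_result_def by blast
  finally show ?thesis .
qed

section \<open>The embedding\<close>

text \<open>Dividing by \<open>sqrt m\<close> makes the expected squared length of an image that of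
  the original vector; the value 0 from index \<open>m\<close> on places the image in the carrier of
  the target space.\<close>

definition sign_projection :: "nat \<Rightarrow> nat \<Rightarrow> (nat \<Rightarrow> nat \<Rightarrow> real) \<Rightarrow> (nat \<Rightarrow> real) \<Rightarrow> nat \<Rightarrow> real" where
  "sign_projection m d w x = (\<lambda>i. if i < m then (\<Sum>j<d. w i j * x j) / sqrt m else 0)"

lemma sign_projection_in_Rn: "sign_projection m d w x \<in> topspace (Euclidean_space m)"
  by (simp add: sign_projection_def topspace_Euclidean_space)

lemma mdist_sign_projection:
  "(mdist (Rn_metric m) (sign_projection m d w x) (sign_projection m d w y))\<^sup>2
    = (\<Sum>i<m. (\<Sum>j<d. w i j * (x j - y j))\<^sup>2) / real m"
proof -
  have "(mdist (Rn_metric m) (sign_projection m d w x) (sign_projection m d w y))\<^sup>2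
    = (\<Sum>i<m. ((\<Sum>j<d. w i j * x j) / sqrt m - (\<Sum>j<d. w i j * y j) / sqrt m)\<^sup>2)"
    by (simp add: mdist_Rn_metric L2_set_def sum_nonneg sign_projection_def)
  also have "\<dots> = (\<Sum>i<m. (\<Sum>j<d. w i j * (x j - y j))\<^sup>2 / real m)"
    by (simp add: power_divide sum_subtractf algebra_simps flip: diff_divide_distrib)
  finally show ?thesis by (simp add: sum_divide_distrib)
qed

lemma mdist_Rn_square: "(mdist (Rn_metric d) x y)\<^sup>2 = (\<Sum>j<d. (x j - y j)\<^sup>2)"
  by (simp add: mdist_Rn_metric L2_set_def sum_nonneg)

text \<open>Two bad events of probability at most 1/6 each leave 2/3. The query is fixed before the
  matrix is drawn, so no union over queries occurs. Restriction to \<open>Y\<close> makes the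
  mapping extensional, as elements of the product space must be.\<close>

lemma sign_projection_preserves_locality:
  fixes \<epsilon> :: real
  assumes X: "finite X" "X \<noteq> {}" "X \<subseteq> Y" and q: "q \<in> Y" and k: "1 \<le> k" and e: "0 < \<epsilon>" "\<epsilon> \<le> 1 / 2" and \<eta>: "0 \<le> \<eta>"
    and m3: "3 \<le> real m * \<epsilon>\<^sup>2" and mX: "real (card X) * exp (- (real m * \<epsilon>\<^sup>2 / 6)) \<le> real k / 6"
  shows "2 / 3 \<le> measure_pmf.prob (sign_matrix_pmf m d)
    {w. preserves_locality (Rn_metric d) (Rn_metric m) X ((1 + \<epsilon>)\<^sup>2) k \<eta> q
      (restrict (sign_projection m d w) Y)}"
    (is "_ \<le> measure_pmf.prob ?M ?G")
proof -
  let ?dY = "mdist (Rn_metric d) q"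
  let ?dZ = "\<lambda>w p. mdist (Rn_metric m) (sign_projection m d w q) (sign_projection m d w p)"
  let ?N = "\<lambda>w. card {p \<in> X. (1 + \<epsilon>) * ?dZ w p < ?dY p}"
  have mpos: "real m > 0" using m3 by (cases "m = 0") auto
  obtain p0 where p0: "p0 \<in> X" and nearest: "\<And>p. p \<in> X \<Longrightarrow> ?dY p0 \<le> ?dY p"
    using ex_is_arg_min_if_finite[OF X(1,2), of ?dY] by (force simp: is_arg_min_linorder)
  let ?A = "{w. ?dZ w p0 > (1 + \<epsilon>) * ?dY p0}"
  let ?B = "{w. ?N w \<ge> k}"
  have "?A \<subseteq> {w. (\<Sum>i<m. (\<Sum>j<d. w i j * (q j - p0 j))\<^sup>2) > (1 + \<epsilon>)\<^sup>2 * (real m * (\<Sum>j<d. (q j - p0 j)\<^sup>2))}"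
  proof
    fix w assume "w \<in> ?A"
    then have "((1 + \<epsilon>) * ?dY p0)\<^sup>2 < (?dZ w p0)\<^sup>2"
      using e by (intro power_strict_mono) auto
    then show "w \<in> {w. (\<Sum>i<m. (\<Sum>j<d. w i j * (q j - p0 j))\<^sup>2) > (1 + \<epsilon>)\<^sup>2 * (real m * (\<Sum>j<d. (q j - p0 j)\<^sup>2))}"
      using mpos by (simp add: power_mult_distrib mdist_Rn_square[of d] mdist_sign_projection
            pos_less_divide_eq mult_ac)
  qed
  then have A: "measure_pmf.prob ?M ?A \<le> 1 / 6"
    by (intro order_trans[OF measure_pmf.finite_measure_mono sign_matrix_expansion[OF refl e(1) m3]]) auto
  have contr: "measure_pmf.prob ?M {w. (1 + \<epsilon>) * ?dZ w p < ?dY p} \<le> exp (- (real m * \<epsilon>\<^sup>2 / 6))" for p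
  proof (cases "?dY p = 0")
    \<comment> \<open>A point at distance 0 from \<open>q\<close> cannot be contracted strictly; the
      tail bound requires a nonzero difference vector.\<close>
    case True
    then have "{w. (1 + \<epsilon>) * ?dZ w p < ?dY p} = {}"
      using e by (auto simp: not_less intro!: mult_nonneg_nonneg)
    then show ?thesis by (simp only: measure_empty) simp
  next
    case False
    then have pos: "(\<Sum>j<d. (q j - p j)\<^sup>2) > 0"
      by (simp flip: mdist_Rn_square)
    have "{w. (1 + \<epsilon>) * ?dZ w p < ?dY p}
      \<subseteq> {w. (1 + \<epsilon>)\<^sup>2 * (\<Sum>i<m. (\<Sum>j<d. w i j * (q j - p j))\<^sup>2) \<le> real m * (\<Sum>j<d. (q j - p j)\<^sup>2)}"
    proof
      fix w assume "w \<in> {w. (1 + \<epsilon>) * ?dZ w p < ?dY p}"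
      then have "((1 + \<epsilon>) * ?dZ w p)\<^sup>2 \<le> (?dY p)\<^sup>2"
        using e by (intro power_mono) auto
      then show "w \<in> {w. (1 + \<epsilon>)\<^sup>2 * (\<Sum>i<m. (\<Sum>j<d. w i j * (q j - p j))\<^sup>2) \<le> real m * (\<Sum>j<d. (q j - p j)\<^sup>2)}"
        using mpos by (simp add: power_mult_distrib mdist_Rn_square[of d] mdist_sign_projection
            pos_divide_le_eq mult_ac)
    qed
    then show ?thesis
      by (intro order_trans[OF measure_pmf.finite_measure_mono sign_matrix_contraction[OF refl pos e]]) auto
  qed
  \<comment> \<open>Markov's inequality for the number of contracted points: its expectation is at
    most \<open>k / 6\<close>, by \<open>mX\<close>.\<close>
  have "measure_pmf.prob ?M ?B
    \<le> measure_pmf.expectation ?M (\<lambda>w. (\<Sum>p\<in>X. indicator {w. (1 + \<epsilon>) * ?dZ w p < ?dY p} w) / real k)"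
  proof (rule prob_le_expectation[OF finite_sign_matrix_pmf])
    fix w
    have "real (?N w) = (\<Sum>p\<in>X. indicator {w. (1 + \<epsilon>) * ?dZ w p < ?dY p} w)"
      using X by (simp add: indicator_def sum.If_cases Int_def)
    moreover have "indicator ?B w \<le> real (?N w) / real k"
      using k by (auto simp: indicator_def)
    ultimately show "indicator ?B w \<le> (\<Sum>p\<in>X. indicator {w. (1 + \<epsilon>) * ?dZ w p < ?dY p} w) / real k"
      by simp
  qed
  also have "\<dots> = (\<Sum>p\<in>X. measure_pmf.prob ?M {w. (1 + \<epsilon>) * ?dZ w p < ?dY p}) / real k"
    by (simp add: Bochner_Integration.integral_sum integrable_measure_pmf_finite[OF finite_sign_matrix_pmf])
  also have "\<dots> \<le> (real (card X) * exp (- (real m * \<epsilon>\<^sup>2 / 6))) / real k"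
    by (intro divide_right_mono sum_bounded_above contr) auto
  also have "\<dots> \<le> 1 / 6"
    using mX k by (simp add: field_simps)
  finally have B: "measure_pmf.prob ?M ?B \<le> 1 / 6" .
  have "- (?A \<union> ?B) \<subseteq> ?G"
  proof
    fix w assume w: "w \<in> - (?A \<union> ?B)"
    have "preserves_locality (Rn_metric d) (Rn_metric m) X ((1 + \<epsilon>)\<^sup>2) k \<eta> q
        (restrict (sign_projection m d w) Y)"
    proof (rule preserves_localityI[OF X(1) p0 _ \<eta> nearest])
      show "mdist (Rn_metric m) (restrict (sign_projection m d w) Y q) (restrict (sign_projection m d w) Y p0)
          \<le> (1 + \<epsilon>) * ?dY p0"
        using w p0 q X(3) by auto
      have "{p \<in> X. (1 + \<epsilon>) * mdist (Rn_metric m) (restrict (sign_projection m d w) Y q)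
            (restrict (sign_projection m d w) Y p) < ?dY p} = {p \<in> X. (1 + \<epsilon>) * ?dZ w p < ?dY p}"
        using q X(3) by auto
      then show "card {p \<in> X. (1 + \<epsilon>) * mdist (Rn_metric m) (restrict (sign_projection m d w) Y q)
            (restrict (sign_projection m d w) Y p) < ?dY p} < k"
        using w by simp
    qed (use e in auto)
    then show "w \<in> ?G" by simp
  qed
  then have "measure_pmf.prob ?M (- (?A \<union> ?B)) \<le> measure_pmf.prob ?M ?G"
    by (intro measure_pmf.finite_measure_mono) auto
  moreover have "measure_pmf.prob ?M (- (?A \<union> ?B)) = 1 - measure_pmf.prob ?M (?A \<union> ?B)"
    using measure_pmf.prob_compl[of "?A \<union> ?B" ?M] by (simp add: Compl_eq_Diff_UNIV)
  moreover have "measure_pmf.prob ?M (?A \<union> ?B) \<le> measure_pmf.prob ?M ?A + measure_pmf.prob ?M ?B"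
    by (intro measure_Un_le) auto
  ultimately show ?thesis using A B by linarith
qed

lemma locality_preserving_embedding_sign_projection:
  fixes \<epsilon> :: real
  assumes X: "finite X" "X \<subseteq> mspace (Rn_metric d)" and k: "1 \<le> k" "k \<le> card X"
    and e: "0 < \<epsilon>" "\<epsilon> \<le> 1 / 2"
    and m3: "3 \<le> real m * \<epsilon>\<^sup>2" and mX: "real (card X) * exp (- (real m * \<epsilon>\<^sup>2 / 6)) \<le> real k / 6"
  shows "locality_preserving_embedding (Rn_metric d) (Rn_metric m) X ((1 + \<epsilon>)\<^sup>2) (2 / 3) k
    (distr (sign_matrix_pmf m d) (Pi\<^sub>M (mspace (Rn_metric d)) (\<lambda>_. metric_borel (Rn_metric m)))
      (\<lambda>w. restrict (sign_projection m d w) (mspace (Rn_metric d))))"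
proof -
  let ?Y = "mspace (Rn_metric d)"
  let ?P = "Pi\<^sub>M ?Y (\<lambda>_. metric_borel (Rn_metric m))"
  let ?T = "\<lambda>w. restrict (sign_projection m d w) ?Y"
  \<comment> \<open>The law of the matrix is discrete, so only membership of the image in the
    product space has to be checked.\<close>
  have T: "?T \<in> measurable (sign_matrix_pmf m d) ?P"
    by (auto simp: space_PiM sign_projection_in_Rn)
  have "2 / 3 \<le> measure (distr (sign_matrix_pmf m d) ?P ?T)
      {f \<in> space ?P. preserves_locality (Rn_metric d) (Rn_metric m) X ((1 + \<epsilon>)\<^sup>2) k \<eta> q f}"
    if \<eta>: "0 \<le> \<eta>" and q: "q \<in> ?Y" for \<eta> q
  proof -
    let ?pres = "preserves_locality (Rn_metric d) (Rn_metric m) X ((1 + \<epsilon>)\<^sup>2) k \<eta> q"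
    have "Measurable.pred ?P ?pres"
    proof (rule pred_preserves_locality[OF X(1) k])
      fix p assume "p \<in> X"
      then have "p \<in> ?Y" using X by blast
      show "(\<lambda>f. mdist (Rn_metric m) (f q) (f p)) \<in> borel_measurable ?P"
        by (rule measurable_Rn_mdist[OF measurable_component_singleton[OF q]
              measurable_component_singleton[OF \<open>p \<in> ?Y\<close>]])
    qed
    then have meas: "{f \<in> space ?P. ?pres f} \<in> sets ?P"
      by (rule predE)
    have "X \<noteq> {}" using k by auto
    have "2 / 3 \<le> measure_pmf.prob (sign_matrix_pmf m d) {w. ?pres (?T w)}"
      by (rule sign_projection_preserves_locality[OF X(1) \<open>X \<noteq> {}\<close> X(2) q k(1) e \<eta> m3 mX])
    also have "{w. ?pres (?T w)} = ?T -` {f \<in> space ?P. ?pres f} \<inter> space (sign_matrix_pmf m d)"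
      using measurable_space[OF T] by auto
    also have "measure_pmf.prob (sign_matrix_pmf m d) \<dots> = measure (distr (sign_matrix_pmf m d) ?P ?T) {f \<in> space ?P. ?pres f}"
      by (rule measure_distr[OF T meas, symmetric])
    finally show ?thesis .
  qed
  moreover have "prob_space (distr (sign_matrix_pmf m d) ?P ?T)"
    by (rule measure_pmf.prob_space_distr[OF T])
  moreover have "1 \<le> (1 + \<epsilon>)\<^sup>2"
    using e by (simp add: one_le_power)
  ultimately show ?thesis
    using X k by (simp add: locality_preserving_embedding_def mapping_distribution_def)
qed

section \<open>Choice of the target dimension\<close>

theorem theorem9:
  shows "\<exists>g :: real \<Rightarrow> real. g \<in> O[at_top](\<lambda>r. ln r) \<and>
    (\<forall>(d::nat) (X :: (nat \<Rightarrow> real) set) (n::nat) (k::nat) (\<epsilon>::real).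
       X \<subseteq> mspace (Rn_metric d) \<and> finite X \<and> card X = n \<and> 1 \<le> k \<and> k \<le> n \<and> 0 < \<epsilon> \<and> \<epsilon> \<le> 1 / 2 \<longrightarrow>
       (\<exists>(d'::nat) (F :: ((nat \<Rightarrow> real) \<Rightarrow> (nat \<Rightarrow> real)) measure).
          real d' \<le> g (real n / real k) / \<epsilon>\<^sup>2 \<and>
          locality_preserving_embedding (Rn_metric d) (Rn_metric d') X ((1 + \<epsilon>)\<^sup>2) (2 / 3) k F))"
proof -
  \<comment> \<open>The main term makes \<open>exp (- (real m * \<epsilon>\<^sup>2 / 6))\<close> at
    most \<open>1 / (6 * r)\<close>, that is \<open>k / (6 * n)\<close>. The summand 1 pays for
    rounding up, because \<open>1 \<le> 1 / \<epsilon>\<^sup>2\<close>.\<close>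
  define g where "g = (\<lambda>r :: real. 6 * (ln 6 + ln r) + 1)"
  have "\<exists>d' F. real d' \<le> g (real n / real k) / \<epsilon>\<^sup>2 \<and>
      locality_preserving_embedding (Rn_metric d) (Rn_metric d') X ((1 + \<epsilon>)\<^sup>2) (2 / 3) k F"
    if X: "X \<subseteq> mspace (Rn_metric d)" "finite X" "card X = n" and k: "1 \<le> k" "k \<le> n"
      and e: "0 < \<epsilon>" "\<epsilon> \<le> 1 / 2" for d X n k and \<epsilon> :: real
  proof -
    define r where "r = real n / real k"
    have r: "1 \<le> r" using k by (simp add: r_def)
    have ln6: "1 \<le> ln (6 :: real)"
      using exp_le by (subst ln_ge_iff) auto
    define z where "z = 6 * (ln 6 + ln r) / \<epsilon>\<^sup>2"
    define m where "m = nat \<lceil>z\<rceil>"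
    have "0 \<le> z" using r ln6 by (auto simp: z_def intro!: divide_nonneg_nonneg add_nonneg_nonneg)
    then have m: "z \<le> real m" "real m \<le> z + 1"
      unfolding m_def by linarith+
    have "1 \<le> 1 / \<epsilon>\<^sup>2"
      using e by (simp add: power_le_one)
    then have bound: "real m \<le> g r / \<epsilon>\<^sup>2"
      using m by (simp add: g_def z_def add_divide_distrib)
    have mln: "6 * (ln 6 + ln r) \<le> real m * \<epsilon>\<^sup>2"
      using m(1) e by (simp add: z_def pos_divide_le_eq)
    have "6 * (1 + 0) \<le> 6 * (ln 6 + ln r)"
      using ln6 r by (intro mult_left_mono add_mono) auto
    then have m3: "3 \<le> real m * \<epsilon>\<^sup>2"
      by (intro order_trans[OF _ mln]) simp
    have "exp (- (real m * \<epsilon>\<^sup>2 / 6)) \<le> exp (- (ln 6 + ln r))"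
      using mln by simp
    also have "\<dots> = 1 / (6 * r)"
      using r by (simp add: exp_minus exp_add exp_diff field_simps)
    finally have "real n * exp (- (real m * \<epsilon>\<^sup>2 / 6)) \<le> real n * (1 / (6 * r))"
      by (intro mult_left_mono) auto
    also have "\<dots> = real k / 6"
      using k by (simp add: r_def)
    finally have "real (card X) * exp (- (real m * \<epsilon>\<^sup>2 / 6)) \<le> real k / 6"
      using X by simp
    then show ?thesis
      using locality_preserving_embedding_sign_projection[OF X(2,1) k(1) _ e m3] bound X k
      unfolding r_def by blast
  qed
  moreover have "g \<in> O[at_top](\<lambda>r. ln r)"
  \<comment> \<open>For \<open>r \<ge> 6\<close> both \<open>ln 6\<close> and 1 are at most
    \<open>ln r\<close>, so \<open>g r \<le> 6 * (2 * ln r) + ln r\<close>. At \<open>r = 1\<close>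
    such a bound fails, since \<open>ln r\<close> vanishes and \<open>g r\<close> does not.\<close>
  proof (rule bigoI[where c = 13])
    have "norm (g r) \<le> 13 * norm (ln r)" if "6 \<le> r" for r
    proof -
      have "ln 6 \<le> ln r" using that by simp
      moreover have "1 \<le> ln (6 :: real)" using exp_le by (subst ln_ge_iff) auto
      ultimately show ?thesis by (simp add: g_def)
    qed
    then show "\<forall>\<^sub>F r in at_top. norm (g r) \<le> 13 * norm (ln r)"
      unfolding eventually_at_top_linorder by blast
  qed
  ultimately show ?thesis by blast
qed

end
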